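(* Let $\mathcal{A}_1,\dots,\mathcal{A}_k$ be commutative, associative, unital, finite-dimensional real algebras and $\mathcal{A}=\mathcal{A}_1\times\cdots\times\mathcal{A}_k$ their direct product with componentwise multiplication. Suppose $p(D)=(p_1(D_1),p_2(D_2),\dots,p_k(D_k))$ where $p(D)\in\mathcal{A}[D]$ and $p_j(D_j)\in\mathcal{A}_j[D_j]$ for $j=1,\dots,k$. Then $w=(w_1,w_2,\dots,w_k)$ is a solution of $p(D)[w]=0$ if and only if $p_j(D_j)[w_j]=0$ for $j=1,2,\dots,k$.
   Context: For a commutative finite-dimensional real unital associative algebra $\mathcal{B}$ and $U\subseteq\mathcal{B}$ open, $f:U\to\mathcal{B}$ is $\mathcal{B}$-differentiable at $q$ if there is a real-linear map $d_qf:\mathcal{B}\to\mathcal{B}$ with $d_qf(xy)=d_qf(x)y$ for all $x,y\in\mathcal{B}$ and $\lim_{h\to0}\frac{f(q+h)-f(q)-d_qf(h)}{\|h\|}=0$ (any norm); then $f'(q)=d_qf(1)$, with higher derivatives by iteration. $D=d/d\zeta$ is differentiation over $\mathcal{A}$ and $D_j=d/d\zeta_j$ is differentiation over $\mathcal{A}_j$, where $\zeta=(\zeta_1,\dots,\zeta_k)$. $\mathcal{B}[D]$ denotes the operators $\sum_i a_iD^i$ with $a_i\in\mathcal{B}$. The notation $p(D)=(p_1(D_1),\dots,p_k(D_k))$ means: if $p(D)=\sum_{i=0}^na_iD^i$ with $a_i=(a_{i1},\dots,a_{ik})\in\mathcal{A}$, then $p_j(D_j)=\sum_{i=0}^na_{ij}D_j^i$.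 The notation $w=(w_1,\dots,w_k)$ means that $w:\mathcal{A}\to\mathcal{A}$ is $w(\zeta_1,\dots,\zeta_k)=(w_1(\zeta_1),\dots,w_k(\zeta_k))$, where $w_j:\mathcal{A}_j\to\mathcal{A}_j$ is $n$-times $\mathcal{A}_j$-differentiable for each $j$. *)

theory Defs
  imports "HOL-Analysis.Analysis" "HOL-Algebra.Ring"
begin

text \<open>
  Finite-dimensional commutative unital associative real algebras. To allow a finite family of
  algebras of different dimensions, the underlying vector space is a finite-dimensional subspace of
  a normed space: addition, scalar multiplication and norm are the ambient ones, while
  multiplication and unit are those of the ring record. Every finite family of such algebras embeds
  in a common ambient space, and the choice of norm is immaterial in finite dimension.
\<close>

locale fd_real_algebra = cring B for B :: "'a::real_normed_vector ring" (structure) +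
  assumes subspace_carrier: "subspace (carrier B)"
    and finite_dim: "\<exists>S. finite S \<and> span S = carrier B"
    and add_eq: "\<lbrakk>x \<in> carrier B; y \<in> carrier B\<rbrakk> \<Longrightarrow> x \<oplus> y = x + y"
    and scaleR_mult: "\<lbrakk>x \<in> carrier B; y \<in> carrier B\<rbrakk> \<Longrightarrow> (c *\<^sub>R x) \<otimes> y = c *\<^sub>R (x \<otimes> y)"

definition direct_product_algebra :: "('k::finite \<Rightarrow> 'a::real_normed_vector ring) \<Rightarrow> ('a ^ 'k) ring" where
  "direct_product_algebra A =
    \<lparr>carrier = {x. \<forall>j. x $ j \<in> carrier (A j)},
     mult = (\<lambda>x y. \<chi> j. x $ j \<otimes>\<^bsub>A j\<^esub> y $ j),
     one = (\<chi> j. \<one>\<^bsub>A j\<^esub>),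
     zero = (\<chi> j. \<zero>\<^bsub>A j\<^esub>),
     add = (\<lambda>x y. \<chi> j. x $ j \<oplus>\<^bsub>A j\<^esub> y $ j)\<rparr>"

lemma fd_real_algebra_direct_product:
  fixes A :: "'k::finite \<Rightarrow> 'a::real_normed_vector ring"
  assumes "\<And>j. fd_real_algebra (A j)"
  shows "fd_real_algebra (direct_product_algebra A)"
proof -
  interpret F: fd_real_algebra "A j" for j
    by (rule assms)
  let ?P = "direct_product_algebra A"
  have "cring ?P"
  proof (intro cringI abelian_groupI comm_monoidI)
    fix x assume x: "x \<in> carrier ?P"
    have "\<forall>j. \<exists>y\<in>carrier (A j). y \<oplus>\<^bsub>A j\<^esub> x $ j = \<zero>\<^bsub>A j\<^esub>"
      using x F.l_neg F.a_inv_closed unfolding direct_product_algebra_def by force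
    then obtain y where "\<And>j. y j \<in> carrier (A j) \<and> y j \<oplus>\<^bsub>A j\<^esub> x $ j = \<zero>\<^bsub>A j\<^esub>"
      by metis
    then show "\<exists>y\<in>carrier ?P. y \<oplus>\<^bsub>?P\<^esub> x = \<zero>\<^bsub>?P\<^esub>"
      by (intro bexI[of _ "\<chi> j. y j"]) (auto simp: direct_product_algebra_def)
  qed (auto simp: direct_product_algebra_def vec_eq_iff F.m_ac F.a_ac F.l_distr F.r_distr)
  moreover have "subspace (carrier ?P)"
    using F.subspace_carrier
    by (auto simp: direct_product_algebra_def subspace_def)
  moreover have "\<exists>S. finite S \<and> span S = carrier ?P"
  proof -
    obtain S where S: "\<And>j. finite (S j)" "\<And>j. span (S j) = carrier (A j)"
      using F.finite_dim by metis
    define T where "T = (\<Union>j. axis j ` S j)"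
    have lin: "linear (axis j :: 'a \<Rightarrow> 'a ^ 'k)" for j
      by (rule linearI) (auto simp: axis_def vec_eq_iff)
    have ax: "axis j ` carrier (A j) \<subseteq> span T" for j
      unfolding S(2)[symmetric] linear_span_image[OF lin, symmetric]
      by (rule span_mono) (auto simp: T_def)
    have "x \<in> span T" if "x \<in> carrier ?P" for x
    proof -
      have "x = (\<Sum>j\<in>UNIV. axis j (x $ j))"
        by (auto simp: vec_eq_iff axis_def if_distrib cong: if_cong)
      also have "\<dots> \<in> span T"
        using that ax by (intro span_sum) (auto simp: direct_product_algebra_def)
      finally show ?thesis .
    qed
    moreover have "span T \<subseteq> carrier ?P"
    proof (rule span_minimal)
      have "s \<in> carrier (A j)" if "s \<in> S j" for s j
        using that S(2) span_base by blast
      moreover have "0 \<in> carrier (A j)" for j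
        using F.subspace_carrier subspace_0 by blast
      ultimately show "T \<subseteq> carrier ?P"
        by (auto simp: T_def direct_product_algebra_def axis_def)
    qed fact
    moreover have "finite T"
      by (auto simp: T_def S)
    ultimately show ?thesis
      by blast
  qed
  ultimately show ?thesis
    by (auto simp: fd_real_algebra_def fd_real_algebra_axioms_def direct_product_algebra_def
        vec_eq_iff F.add_eq F.scaleR_mult)
qed

text \<open>
  Being differentiable at \<open>q\<close> is a local property, so no domain is recorded. Only the values of
  \<open>f\<close> and \<open>d\<close> on the algebra matter.
\<close>

definition has_alg_differential ::
    "'a::real_normed_vector ring \<Rightarrow> ('a \<Rightarrow> 'a) \<Rightarrow> ('a \<Rightarrow> 'a) \<Rightarrow> 'a \<Rightarrow> bool" where
  "has_alg_differential B f d q \<longleftrightarrow>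
     d \<in> carrier B \<rightarrow> carrier B \<and>
     (\<forall>x\<in>carrier B. \<forall>y\<in>carrier B. d (x + y) = d x + d y) \<and>
     (\<forall>c. \<forall>x\<in>carrier B. d (c *\<^sub>R x) = c *\<^sub>R d x) \<and>
     (\<forall>x\<in>carrier B. \<forall>y\<in>carrier B. d (x \<otimes>\<^bsub>B\<^esub> y) = d x \<otimes>\<^bsub>B\<^esub> y) \<and>
     ((\<lambda>h. (f (q + h) - f q - d h) /\<^sub>R norm h) \<longlongrightarrow> 0) (at 0 within carrier B)"

definition alg_differentiable :: "'a::real_normed_vector ring \<Rightarrow> ('a \<Rightarrow> 'a) \<Rightarrow> 'a \<Rightarrow> bool" where
  "alg_differentiable B f q \<longleftrightarrow> (\<exists>d. has_alg_differential B f d q)"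

text \<open>Unspecified where \<open>f\<close> is not differentiable.\<close>

definition alg_deriv :: "'a::real_normed_vector ring \<Rightarrow> ('a \<Rightarrow> 'a) \<Rightarrow> 'a \<Rightarrow> 'a" where
  "alg_deriv B f q = (THE c. \<exists>d. has_alg_differential B f d q \<and> c = d \<one>\<^bsub>B\<^esub>)"

definition alg_differentiable_times ::
    "'a::real_normed_vector ring \<Rightarrow> nat \<Rightarrow> ('a \<Rightarrow> 'a) \<Rightarrow> bool" where
  "alg_differentiable_times B n f \<longleftrightarrow>
     (\<forall>i<n. \<forall>q\<in>carrier B. alg_differentiable B ((alg_deriv B ^^ i) f) q)"

definition diff_operator ::
    "'a::real_normed_vector ring \<Rightarrow> nat \<Rightarrow> (nat \<Rightarrow> 'a) \<Rightarrow> ('a \<Rightarrow> 'a) \<Rightarrow> 'a \<Rightarrow> 'a" where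
  "diff_operator B n a f \<zeta> = (\<Sum>i\<le>n. a i \<otimes>\<^bsub>B\<^esub> (alg_deriv B ^^ i) f \<zeta>)"

text \<open>A solution is required to be regular enough for the operator to be applied to it.\<close>

definition is_solution ::
    "'a::real_normed_vector ring \<Rightarrow> nat \<Rightarrow> (nat \<Rightarrow> 'a) \<Rightarrow> ('a \<Rightarrow> 'a) \<Rightarrow> bool" where
  "is_solution B n a f \<longleftrightarrow>
     f \<in> carrier B \<rightarrow> carrier B \<and> alg_differentiable_times B n f \<and>
     (\<forall>\<zeta>\<in>carrier B. diff_operator B n a f \<zeta> = 0)"

end

theory Submission imports Defs begin

text \<open>
  The direct product of differentials of the components is a differential of the product map, the
  remainder being controlled because \<open>norm (h $ j) \<le> norm h\<close>. Since the value of a differential at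
  the unit is unique, every derivative of \<open>w\<close> is computed componentwise, so the \<open>j\<close>-th component
  of \<open>p(D)[w]\<close> at \<open>\<zeta>\<close> is \<open>p\<^sub>j(D\<^sub>j)[w\<^sub>j]\<close> at \<open>\<zeta> $ j\<close>.
\<close>

text \<open>Subtracting the two remainder quotients cancels \<open>f\<close>, so
  \<open>e h - d h\<close> is small compared with \<open>norm h\<close> along the carrier. On the
  ray through the unit the quotient is constant by homogeneity, hence zero. This is what gives the
  definite description in \<open>alg_deriv\<close> its meaning.\<close>

lemma has_alg_differential_one_unique:
  assumes "fd_real_algebra B"
    and d: "has_alg_differential B f d q" and e: "has_alg_differential B f e q"
  shows "d \<one>\<^bsub>B\<^esub> = e \<one>\<^bsub>B\<^esub>"
proof -
  interpret fd_real_algebra B by fact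
  let ?u = "\<one>\<^bsub>B\<^esub>"
  have sub: "c *\<^sub>R ?u \<in> carrier B" for c
    using subspace_carrier by (simp add: subspace_scale)
  have lin: "d (c *\<^sub>R ?u) = c *\<^sub>R d ?u" "e (c *\<^sub>R ?u) = c *\<^sub>R e ?u" for c
    using d e by (auto simp: has_alg_differential_def)
  show ?thesis
  proof (cases "?u = 0")
    \<comment> \<open>The zero algebra has no ray to approach along; homogeneity with scalar 0 sends
      the unit to 0 under both maps.\<close>
    case True
    then show ?thesis using lin[of 0] by simp
  next
    case False
    have "((\<lambda>h. (f (q + h) - f q - d h) /\<^sub>R norm h - (f (q + h) - f q - e h) /\<^sub>R norm h) \<longlongrightarrow> 0 - 0)
      (at 0 within carrier B)"
      using d e unfolding has_alg_differential_def by (intro tendsto_diff) auto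
    then have "((\<lambda>h. (e h - d h) /\<^sub>R norm h) \<longlongrightarrow> 0) (at 0 within carrier B)"
      by (simp add: scaleR_diff_right[symmetric])
    \<comment> \<open>For \<open>t > 0\<close> the point \<open>t *\<^sub>R ?u\<close> is nonzero
      and in the carrier, so the limit may be taken along this ray. One-sidedness makes the factor
      \<open>t\<close> cancel against \<open>norm (t *\<^sub>R ?u)\<close> without a sign.\<close>
    moreover have "filterlim (\<lambda>t. t *\<^sub>R ?u) (at 0 within carrier B) (at_right (0::real))"
      unfolding filterlim_at
      using False sub
      by (auto intro!: tendsto_eq_intros simp: eventually_at_filter)
    ultimately have "((\<lambda>t. (e (t *\<^sub>R ?u) - d (t *\<^sub>R ?u)) /\<^sub>R norm (t *\<^sub>R ?u)) \<longlongrightarrow> 0) (at_right 0)"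
      by (rule filterlim_compose)
    moreover have "\<forall>\<^sub>F t in at_right 0. (e (t *\<^sub>R ?u) - d (t *\<^sub>R ?u)) /\<^sub>R norm (t *\<^sub>R ?u) = (e ?u - d ?u) /\<^sub>R norm ?u"
      by (auto simp: eventually_at_filter lin scaleR_diff_right[symmetric])
    ultimately have "((\<lambda>t::real. (e ?u - d ?u) /\<^sub>R norm ?u) \<longlongrightarrow> 0) (at_right 0)"
      by (simp cong: tendsto_cong)
    then have "(e ?u - d ?u) /\<^sub>R norm ?u = 0"
      by (simp add: tendsto_const_iff)
    then show ?thesis
      using False by simp
  qed
qed

lemma alg_deriv_eqI:
  assumes "fd_real_algebra B" "has_alg_differential B f d q"
  shows "alg_deriv B f q = d \<one>\<^bsub>B\<^esub>"
  unfolding alg_deriv_def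
  using assms has_alg_differential_one_unique[OF assms(1)] by (intro the_equality) blast+

lemma has_alg_differential_direct_product:
  fixes A :: "'k::finite \<Rightarrow> 'a::real_normed_vector ring"
  assumes A: "\<And>j. fd_real_algebra (A j)"
    and q: "q \<in> carrier (direct_product_algebra A)"
    and f: "\<And>\<zeta>. \<zeta> \<in> carrier (direct_product_algebra A) \<Longrightarrow> f \<zeta> = (\<chi> j. g j (\<zeta> $ j))"
    and d: "\<And>j. has_alg_differential (A j) (g j) (d j) (q $ j)"
  shows "has_alg_differential (direct_product_algebra A) f (\<lambda>h. \<chi> j. d j (h $ j)) q"
proof -
  let ?P = "direct_product_algebra A"
  interpret P: fd_real_algebra ?P
    by (rule fd_real_algebra_direct_product) (rule A)
  have cP: "x $ j \<in> carrier (A j)" if "x \<in> carrier ?P" for x j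
    using that by (simp add: direct_product_algebra_def)
  have "((\<lambda>h. (f (q + h) - f q - (\<chi> j. d j (h $ j))) /\<^sub>R norm h) \<longlongrightarrow> 0) (at 0 within carrier ?P)"
  proof (rule vec_tendstoI)
    fix j
    interpret F: fd_real_algebra "A j" by (rule A)
    define r where "r k = g j (q $ j + k) - g j (q $ j) - d j k" for k
    \<comment> \<open>A nonzero \<open>h\<close> may have \<open>h $ j = 0\<close>; this gives
      \<open>r 0 = 0\<close> there.\<close>
    have d0: "d j 0 = 0"
    proof -
      have "d j (0 *\<^sub>R 0) = 0 *\<^sub>R d j 0"
        using d[of j] subspace_0[OF F.subspace_carrier]
        unfolding has_alg_differential_def by blast
      then show ?thesis by simp
    qed
    have "((\<lambda>k. r k /\<^sub>R norm k) \<longlongrightarrow> 0) (at 0 within carrier (A j))"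
      using d[of j] by (simp add: has_alg_differential_def r_def)
    \<comment> \<open>At \<open>k = 0\<close> the quotient is 0, since the inverse of 0 is 0, so the
      limit is the value. Continuity is the right form for the composition: \<open>h $ j\<close> may
      equal 0 however close \<open>h\<close> is to 0, which a punctured limit would exclude.\<close>
    then have "continuous (at 0 within carrier (A j)) (\<lambda>k. r k /\<^sub>R norm k)"
      by (simp add: continuous_within)
    moreover have "((\<lambda>h. h $ j) \<longlongrightarrow> 0) (at 0 within carrier ?P)"
      by (auto intro!: tendsto_eq_intros)
    moreover have "\<forall>\<^sub>F h in at 0 within carrier ?P. h $ j \<in> carrier (A j)"
      by (simp add: eventually_at_filter cP)
    ultimately have "((\<lambda>h. r (h $ j) /\<^sub>R norm (h $ j)) \<longlongrightarrow> 0) (at 0 within carrier ?P)"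
      using continuous_within_tendsto_compose[of 0 "carrier (A j)" "\<lambda>k. r k /\<^sub>R norm k"] by force
    \<comment> \<open>Dividing by \<open>norm h\<close> instead of the smaller
      \<open>norm (h $ j)\<close> only shrinks the quotient; the constant 1 matches the form of
      \<open>tendsto_0_le\<close>.\<close>
    moreover have "\<forall>\<^sub>F h in at 0 within carrier ?P.
        norm (((f (q + h) - f q - (\<chi> j. d j (h $ j))) /\<^sub>R norm h) $ j)
          \<le> norm (r (h $ j) /\<^sub>R norm (h $ j)) * 1"
      unfolding eventually_at_filter
    proof (intro always_eventually allI impI)
      fix h :: "'a ^ 'k"
      assume h: "h \<noteq> 0" "h \<in> carrier ?P"
      \<comment> \<open>The componentwise form of \<open>f\<close> is known only on the carrier, so
        both \<open>q\<close> and \<open>q + h\<close> must lie there.\<close>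
      have "q + h \<in> carrier ?P"
        using q h P.subspace_carrier by (simp add: subspace_add)
      then have eq: "((f (q + h) - f q - (\<chi> j. d j (h $ j))) /\<^sub>R norm h) $ j = r (h $ j) /\<^sub>R norm h"
        using q by (simp add: f r_def)
      show "norm (((f (q + h) - f q - (\<chi> j. d j (h $ j))) /\<^sub>R norm h) $ j)
          \<le> norm (r (h $ j) /\<^sub>R norm (h $ j)) * 1"
      proof (cases "h $ j = 0")
        case True
        then show ?thesis unfolding eq by (simp add: r_def d0)
      next
        case False
        then show ?thesis
          unfolding eq using h Finite_Cartesian_Product.norm_nth_le[of h j]
          by (simp add: mult_right_mono)
      qed
    qed
    ultimately have "((\<lambda>h. ((f (q + h) - f q - (\<chi> j. d j (h $ j))) /\<^sub>R norm h) $ j) \<longlongrightarrow> 0)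
        (at 0 within carrier ?P)"
      by (rule tendsto_0_le)
    then show "((\<lambda>h. ((f (q + h) - f q - (\<chi> j. d j (h $ j))) /\<^sub>R norm h) $ j) \<longlongrightarrow> 0 $ j)
        (at 0 within carrier ?P)"
      by simp
  qed
  moreover have "d j \<in> carrier (A j) \<rightarrow> carrier (A j)" for j
    using d[of j] by (simp add: has_alg_differential_def)
  moreover have "d j (c *\<^sub>R x) = c *\<^sub>R d j x" if "x \<in> carrier (A j)" for j x c
    using d[of j] that by (simp add: has_alg_differential_def)
  moreover have "d j (x + y) = d j x + d j y"
    "d j (x \<otimes>\<^bsub>A j\<^esub> y) = d j x \<otimes>\<^bsub>A j\<^esub> y"
    if "x \<in> carrier (A j)" "y \<in> carrier (A j)" for j x y
    using d[of j] that by (auto simp: has_alg_differential_def)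
  ultimately show ?thesis
    unfolding has_alg_differential_def
    by (auto simp: direct_product_algebra_def vec_eq_iff Pi_iff)
qed

text \<open>The components of the product unit are the units of the factors, so evaluating the
  product differential there yields the derivatives of the factors.\<close>

lemma alg_deriv_direct_product:
  fixes A :: "'k::finite \<Rightarrow> 'a::real_normed_vector ring"
  assumes A: "\<And>j. fd_real_algebra (A j)"
    and q: "q \<in> carrier (direct_product_algebra A)"
    and f: "\<And>\<zeta>. \<zeta> \<in> carrier (direct_product_algebra A) \<Longrightarrow> f \<zeta> = (\<chi> j. g j (\<zeta> $ j))"
    and g: "\<And>j. alg_differentiable (A j) (g j) (q $ j)"
  shows "alg_differentiable (direct_product_algebra A) f q"
    and "alg_deriv (direct_product_algebra A) f q = (\<chi> j. alg_deriv (A j) (g j) (q $ j))"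
proof -
  let ?P = "direct_product_algebra A"
  have P: "fd_real_algebra ?P"
    by (rule fd_real_algebra_direct_product) (rule A)
  obtain d where d: "\<And>j. has_alg_differential (A j) (g j) (d j) (q $ j)"
    using g unfolding alg_differentiable_def by metis
  have D: "has_alg_differential ?P f (\<lambda>h. \<chi> j. d j (h $ j)) q"
    by (rule has_alg_differential_direct_product[OF A q f d])
  then show "alg_differentiable ?P f q"
    unfolding alg_differentiable_def by blast
  show "alg_deriv ?P f q = (\<chi> j. alg_deriv (A j) (g j) (q $ j))"
    using alg_deriv_eqI[OF P D] alg_deriv_eqI[OF A d]
    by (simp add: direct_product_algebra_def)
qed

text \<open>Order \<open>i = n\<close> is included because the \<open>i\<close>-th derivative only
  uses differentiability of the orders below \<open>i\<close>.\<close>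

lemma alg_deriv_funpow_direct_product:
  fixes A :: "'k::finite \<Rightarrow> 'a::real_normed_vector ring"
  assumes A: "\<And>j. fd_real_algebra (A j)"
    and f: "\<And>\<zeta>. \<zeta> \<in> carrier (direct_product_algebra A) \<Longrightarrow> f \<zeta> = (\<chi> j. g j (\<zeta> $ j))"
    and g: "\<And>j. alg_differentiable_times (A j) n (g j)"
    and "i \<le> n" "\<zeta> \<in> carrier (direct_product_algebra A)"
  shows "(alg_deriv (direct_product_algebra A) ^^ i) f \<zeta> = (\<chi> j. (alg_deriv (A j) ^^ i) (g j) (\<zeta> $ j))"
  using assms(4,5)
\<comment> \<open>The point stays arbitrary: differentiating the identity for order \<open>i\<close>
  needs it on the whole carrier.\<close>
proof (induction i arbitrary: \<zeta>)
  case 0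
  then show ?case by (simp add: f)
next
  case (Suc i)
  have "alg_differentiable (A j) ((alg_deriv (A j) ^^ i) (g j)) (\<zeta> $ j)" for j
    using g[of j] Suc.prems by (auto simp: alg_differentiable_times_def direct_product_algebra_def)
  then show ?case
    using Suc by (simp add: alg_deriv_direct_product(2)[OF A])
qed

lemma alg_differentiable_times_direct_product:
  fixes A :: "'k::finite \<Rightarrow> 'a::real_normed_vector ring"
  assumes A: "\<And>j. fd_real_algebra (A j)"
    and f: "\<And>\<zeta>. \<zeta> \<in> carrier (direct_product_algebra A) \<Longrightarrow> f \<zeta> = (\<chi> j. g j (\<zeta> $ j))"
    and g: "\<And>j. alg_differentiable_times (A j) n (g j)"
  shows "alg_differentiable_times (direct_product_algebra A) n f"
  unfolding alg_differentiable_times_def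
proof (intro allI impI ballI)
  fix i q
  assume i: "i < n" and q: "q \<in> carrier (direct_product_algebra A)"
  have "alg_differentiable (A j) ((alg_deriv (A j) ^^ i) (g j)) (q $ j)" for j
    using g[of j] i q by (auto simp: alg_differentiable_times_def direct_product_algebra_def)
  then show "alg_differentiable (direct_product_algebra A) ((alg_deriv (direct_product_algebra A) ^^ i) f) q"
    using alg_deriv_funpow_direct_product[OF A f g, of i] i q
    by (intro alg_deriv_direct_product(1)[OF A]) auto
qed

theorem theorem5p11:
  fixes \<A> :: "'k::finite \<Rightarrow> 'a::real_normed_vector ring"
    and n :: nat
    and a :: "nat \<Rightarrow> 'a ^ 'k"
    and p :: "'k \<Rightarrow> nat \<Rightarrow> 'a"
    and w :: "'a ^ 'k \<Rightarrow> 'a ^ 'k"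
    and v :: "'k \<Rightarrow> 'a \<Rightarrow> 'a"
  assumes algebras: "\<forall>j. fd_real_algebra (\<A> j)"
    and coeffs: "\<forall>i\<le>n. a i \<in> carrier (direct_product_algebra \<A>)"
    and component_coeffs: "\<forall>j. \<forall>i\<le>n. p j i \<in> carrier (\<A> j)"
    and operator_components: "\<forall>i\<le>n. a i = (\<chi> j. p j i)"
    and maps: "\<forall>j. v j \<in> carrier (\<A> j) \<rightarrow> carrier (\<A> j)"
    and differentiable: "\<forall>j. alg_differentiable_times (\<A> j) n (v j)"
    and function_components: "\<forall>\<zeta>\<in>carrier (direct_product_algebra \<A>). w \<zeta> = (\<chi> j. v j (\<zeta> $ j))"
  shows "is_solution (direct_product_algebra \<A>) n a w \<longleftrightarrow> (\<forall>j. is_solution (\<A> j) n (p j) (v j))"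
proof -
  let ?P = "direct_product_algebra \<A>"
  note A = algebras[rule_format] and f = function_components[rule_format]
    and g = differentiable[rule_format]
  \<comment> \<open>The mapping and regularity clauses of \<open>is_solution\<close> hold on both
    sides of the equivalence, which leaves only the vanishing of the operators to compare.\<close>
  have "w \<in> carrier ?P \<rightarrow> carrier ?P"
    using maps function_components by (auto simp: direct_product_algebra_def Pi_iff)
  then have P: "is_solution ?P n a w \<longleftrightarrow> (\<forall>\<zeta>\<in>carrier ?P. diff_operator ?P n a w \<zeta> = 0)"
    using alg_differentiable_times_direct_product[OF A f g] by (simp add: is_solution_def)
  have F: "is_solution (\<A> j) n (p j) (v j) \<longleftrightarrow>
      (\<forall>z\<in>carrier (\<A> j). diff_operator (\<A> j) n (p j) (v j) z = 0)" for j
    using maps g[of j] by (simp add: is_solution_def)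
  \<comment> \<open>Products and derivatives are componentwise and taking a component commutes with
    the finite sum, so the \<open>j\<close>-th component depends on \<zeta> only through
    \<open>\<zeta> $ j\<close>.\<close>
  have op: "diff_operator ?P n a w \<zeta> $ j = diff_operator (\<A> j) n (p j) (v j) (\<zeta> $ j)"
    if "\<zeta> \<in> carrier ?P" for \<zeta> j
  proof -
    have "(a i \<otimes>\<^bsub>?P\<^esub> (alg_deriv ?P ^^ i) w \<zeta>) $ j
        = p j i \<otimes>\<^bsub>\<A> j\<^esub> (alg_deriv (\<A> j) ^^ i) (v j) (\<zeta> $ j)" if "i \<le> n" for i
      using alg_deriv_funpow_direct_product[OF A f g \<open>i \<le> n\<close> \<open>\<zeta> \<in> carrier ?P\<close>]
        operator_components that
      by (simp add: direct_product_algebra_def)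
    then show ?thesis
      by (simp add: diff_operator_def)
  qed
  show ?thesis
    unfolding P F
  proof (intro iffI allI ballI)
    fix j z
    assume L: "\<forall>\<zeta>\<in>carrier ?P. diff_operator ?P n a w \<zeta> = 0" and z: "z \<in> carrier (\<A> j)"
    \<comment> \<open>Every \<open>z\<close> in the \<open>j\<close>-th factor must occur as the
      \<open>j\<close>-th coordinate of a point of the product; \<open>axis j z\<close> fills the
      other coordinates with 0, which lies in every carrier.\<close>
    have "0 \<in> carrier (\<A> i)" for i
      using fd_real_algebra.subspace_carrier[OF A] by (rule subspace_0)
    then have "axis j z \<in> carrier ?P"
      using z by (auto simp: direct_product_algebra_def axis_def)
    then show "diff_operator (\<A> j) n (p j) (v j) z = 0"
      using op[of "axis j z" j] L by simp
  next
    fix \<zeta>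
    assume "\<forall>j. \<forall>z\<in>carrier (\<A> j). diff_operator (\<A> j) n (p j) (v j) z = 0"
      and "\<zeta> \<in> carrier ?P"
    moreover from this have "\<zeta> $ j \<in> carrier (\<A> j)" for j
      by (simp add: direct_product_algebra_def)
    ultimately show "diff_operator ?P n a w \<zeta> = 0"
      by (simp add: vec_eq_iff op)
  qed
qed

end
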